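(* Let $f:\mathbb{R}^d\to\mathbb{R}$ be convex and differentiable with Lipschitz continuous gradient (constant $L>0$), let $g:\mathbb{R}^{d'}\to\mathbb{R}\cup\{+\infty\}$ be proper, convex and lower semi-continuous, let $h:\mathbb{R}^d\to\mathbb{R}$ be $h=0$, and let $A:\mathbb{R}^d\to\mathbb{R}^{d'}$ be linear. Let $0<\alpha<2/L$, $0<\beta<1/\|A\|^2$, and let $k_{\max}\ge 1$ be an integer. Assume in addition that $f$ is strongly convex with parameter $\mu>0$, and that $A^T$ is coercive with parameter $\sigma>0$, i.e. $\|A^Tv\|_2\geq\sigma\|v\|_2$ for all $v\in\mathbb{R}^{d'}$. Let $u_0\in\mathbb{R}^d$ and $v_0^0\in\mathbb{R}^{d'}$ be arbitrary, and let $u_n$, $v_n^0$ ($n\geq 0$) be generated by the nested primal-dual algorithm with parameters $\alpha,\beta,k_{\max}$ (described in the context). Then the problem $$\min_{u\in\mathbb{R}^d} f(u)+g(Au)+h(u)$$ has a unique minimizer $\hat u$, and there exist a dual variable $\hat v\in\mathbb{R}^{d'}$ satisfying $$\hat u=\mathrm{prox}_{\alpha h}\left(\hat u-\alpha\nabla f(\hat u)-\alpha A^T\hat v\right),\qquad \hat v=\mathrm{prox}_{\beta\alpha^{-1}g^\ast}\left(\hat v+\beta\alpha^{-1}A\hat u\right),$$ and a constant $\epsilon$ with $0\le\epsilon<1$, such that, with $\gamma=1/k_{\max}$, for all $n\geq 0$, $$\beta\|u_{n+1}-\hat u\|_2^2+\alpha^2\gamma\|v_{n+1}^0-\hat v\|_2^2\leq\epsilon\left(\beta\|u_n-\hat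 u\|_2^2+\alpha^2\gamma\|v_n^0-\hat v\|_2^2\right).$$ In particular $u_n$ converges to $\hat u$ at a linear rate.
   Context: $\|\cdot\|_2$ is the Euclidean norm, $\langle\cdot,\cdot\rangle$ the Euclidean inner product, and $\|A\|$ is the largest singular value of $A$. $f$ is strongly convex with parameter $\mu$ if $f(u)\geq f(v)+\langle\nabla f(v),u-v\rangle+\frac{\mu}{2}\|u-v\|_2^2$ for all $u,v\in\mathbb{R}^d$. For a proper convex lower semi-continuous function $p:\mathbb{R}^m\to\mathbb{R}\cup\{+\infty\}$: the proximal operator is $\mathrm{prox}_p(a)=\arg\min_{u\in\mathbb{R}^m}\frac12\|u-a\|_2^2+p(u)$; the Fenchel dual is $p^\ast(w)=\sup_u\langle w,u\rangle-p(u)$. (For $h=0$, $\mathrm{prox}_{\alpha h}$ is the identity.) Nested primal-dual algorithm. Given $u_0$ and $v_0^0$, for $n=0,1,2,\ldots$: (i) if $n>0$, set $v_n^0=v_{n-1}^{k_{\max}}$; (ii) for $k=0,\ldots,k_{\max}-1$, set $$u_n^k=\mathrm{prox}_{\alpha h}\left(u_n-\alpha\nabla f(u_n)-\alpha A^Tv_n^k\right),\qquad v_n^{k+1}=\mathrm{prox}_{\beta\alpha^{-1}g^\ast}\left(v_n^k+\beta\alpha^{-1}Au_n^k\right);$$ (iii) set $u_n^{k_{\max}}=\mathrm{prox}_{\alpha h}\left(u_n-\alpha\nabla f(u_n)-\alpha A^Tv_n^{k_{\max}}\right)$; (iv) set $u_{n+1}=\frac{1}{k_{\max}}\sum_{k=1}^{k_{\max}}u_n^k$.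 *)

theory Defs
  imports "HOL-Analysis.Analysis"
begin

section \<open>Extended-valued convex functions\<close>

text \<open>Functions into \<open>\<real> \<union> {+\<infinity>}\<close> are modelled as \<^typ>\<open>ereal\<close>-valued functions; properness
  excludes the value \<open>-\<infinity>\<close>.\<close>

definition proper :: "('a \<Rightarrow> ereal) \<Rightarrow> bool" where
  "proper p \<longleftrightarrow> (\<forall>x. p x \<noteq> -\<infinity>) \<and> (\<exists>x. p x \<noteq> \<infinity>)"

definition convex_ereal :: "('a::real_vector \<Rightarrow> ereal) \<Rightarrow> bool" where
  "convex_ereal p \<longleftrightarrow>
     (\<forall>x y. \<forall>t::real. 0 < t \<and> t < 1 \<longrightarrow>
        p ((1 - t) *\<^sub>R x + t *\<^sub>R y) \<le> ereal (1 - t) * p x + ereal t * p y)"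

definition lower_semicontinuous :: "('a::topological_space \<Rightarrow> ereal) \<Rightarrow> bool" where
  "lower_semicontinuous p \<longleftrightarrow> (\<forall>x. p x \<le> Liminf (at x) p)"

definition prox :: "('a::euclidean_space \<Rightarrow> ereal) \<Rightarrow> 'a \<Rightarrow> 'a" where
  "prox p a = arg_min (\<lambda>u. ereal (1 / 2 * (norm (u - a))\<^sup>2) + p u) (\<lambda>_. True)"

definition fenchel_dual :: "('a::euclidean_space \<Rightarrow> ereal) \<Rightarrow> 'a \<Rightarrow> ereal" where
  "fenchel_dual p w = (SUP u. ereal (w \<bullet> u) - p u)"

definition strongly_convex ::
  "('a::euclidean_space \<Rightarrow> real) \<Rightarrow> ('a \<Rightarrow> 'a) \<Rightarrow> real \<Rightarrow> bool" where
  \<comment> \<open>the second argument is the gradient of the first\<close>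
  "strongly_convex f grad_f \<mu> \<longleftrightarrow>
     (\<forall>u v. f u \<ge> f v + grad_f v \<bullet> (u - v) + \<mu> / 2 * (norm (u - v))\<^sup>2)"


section \<open>Largest singular value\<close>

definition singular_values :: "('a::euclidean_space \<Rightarrow> 'b::euclidean_space) \<Rightarrow> real set" where
  "singular_values A = {sqrt c |c. \<exists>x. x \<noteq> 0 \<and> adjoint A (A x) = c *\<^sub>R x}"

definition largest_singular_value :: "('a::euclidean_space \<Rightarrow> 'b::euclidean_space) \<Rightarrow> real" where
  "largest_singular_value A = Max (singular_values A)"

lemma finite_singular_values:
  fixes A :: "'a::euclidean_space \<Rightarrow> 'b::euclidean_space"
  assumes "linear A"
  shows "finite (singular_values A)"
proof -
  define E where "E = {c. \<exists>x. x \<noteq> 0 \<and> adjoint A (A x) = c *\<^sub>R x}"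
  have "\<exists>e. \<forall>c\<in>E. e c \<noteq> 0 \<and> adjoint A (A (e c)) = c *\<^sub>R e c"
    unfolding E_def by (intro bchoice) auto
  then obtain e where e: "\<And>c. c \<in> E \<Longrightarrow> e c \<noteq> 0"
      "\<And>c. c \<in> E \<Longrightarrow> adjoint A (A (e c)) = c *\<^sub>R e c"
    by blast
  have orth: "e k \<bullet> e l = 0" if "k \<in> E" "l \<in> E" "k \<noteq> l" for k l
  proof -
    have "k * (e k \<bullet> e l) = adjoint A (A (e k)) \<bullet> e l"
      using e that by simp
    also have "\<dots> = e k \<bullet> adjoint A (A (e l))"
      by (simp add: adjoint_clauses[OF assms])
    also have "\<dots> = l * (e k \<bullet> e l)"
      using e that by simp
    finally show ?thesis
      using that by simp
  qed
  have "inj_on e E"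
    by (rule inj_onI) (metis e(1) orth inner_eq_zero_iff)
  moreover have "finite (e ` E)"
  proof -
    have "pairwise orthogonal (e ` E)"
      unfolding pairwise_def orthogonal_def using orth by auto
    moreover have "0 \<notin> e ` E"
      using e(1) by force
    ultimately show ?thesis
      using pairwise_orthogonal_independent independent_imp_finite by blast
  qed
  ultimately have "finite E"
    using finite_imageD by blast
  moreover have "singular_values A = sqrt ` E"
    by (auto simp: singular_values_def E_def)
  ultimately show ?thesis
    by simp
qed

lemma onorm_in_singular_values:
  fixes A :: "'a::euclidean_space \<Rightarrow> 'b::euclidean_space"
  assumes "linear A"
  shows "onorm A \<in> singular_values A"
proof -
  have bl: "bounded_linear A"
    using assms by (rule linear_conv_bounded_linear[THEN iffD1])
  have ne: "sphere (0::'a) 1 \<noteq> {}"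
    using nonempty_Basis norm_Basis by fastforce
  have "continuous_on (sphere 0 1) (\<lambda>x. norm (A x))"
    by (intro continuous_on_norm linear_continuous_on bl)
  then obtain x where "x \<in> sphere 0 1" "\<forall>y\<in>sphere 0 1. norm (A y) \<le> norm (A x)"
    using continuous_attains_sup[OF compact_sphere ne] by blast
  then have x: "norm x = 1" "\<And>y. norm y = 1 \<Longrightarrow> norm (A y) \<le> norm (A x)"
    by auto
  have le: "norm (A y) \<le> norm (A x) * norm y" for y
  proof (cases "y = 0")
    case True
    then show ?thesis using linear_0[OF assms] by simp
  next
    case False
    then have "norm (A (y /\<^sub>R norm y)) \<le> norm (A x)"
      by (intro x(2)) simp
    then show ?thesis
      using False by (simp add: linear_scale[OF assms] field_simps)
  qed
  define m where "m = norm (A x)"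
  have m: "onorm A = m"
  proof (rule antisym)
    show "onorm A \<le> m"
      unfolding m_def by (rule onorm_le) (rule le)
    show "m \<le> onorm A"
      using onorm[OF bl, of x] x(1) by (simp add: m_def)
  qed
  have adj: "norm (adjoint A y) \<le> m * norm y" for y
  proof (cases "adjoint A y = 0")
    case True
    then show ?thesis by (simp add: m_def)
  next
    case False
    have "(norm (adjoint A y))\<^sup>2 = A (adjoint A y) \<bullet> y"
      by (simp add: power2_norm_eq_inner adjoint_clauses[OF assms])
    also have "\<dots> \<le> norm (A (adjoint A y)) * norm y"
      by (rule norm_cauchy_schwarz)
    also have "\<dots> \<le> (m * norm (adjoint A y)) * norm y"
      unfolding m_def by (intro mult_right_mono le) simp
    finally show ?thesis
      using False by (simp add: power2_eq_square)
  qed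
  have sq: "(norm (adjoint A (A x)))\<^sup>2 \<le> (m * m)\<^sup>2"
    using adj[of "A x"] by (intro power_mono) (simp_all add: m_def)
  define y where "y = adjoint A (A x)"
  have yx: "y \<bullet> x = m\<^sup>2"
    by (simp add: y_def adjoint_clauses[OF assms] m_def power2_norm_eq_inner)
  have xx: "x \<bullet> x = 1"
    using x(1) by (simp add: dot_square_norm)
  have "(y - m\<^sup>2 *\<^sub>R x) \<bullet> (y - m\<^sup>2 *\<^sub>R x) = y \<bullet> y - 2 * m\<^sup>2 * (y \<bullet> x) + m\<^sup>2 * m\<^sup>2 * (x \<bullet> x)"
    by (simp add: inner_diff_left inner_diff_right inner_commute algebra_simps)
  then have "(norm (adjoint A (A x) - m\<^sup>2 *\<^sub>R x))\<^sup>2 = (norm (adjoint A (A x)))\<^sup>2 - (m * m)\<^sup>2"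
    by (simp add: yx xx power2_norm_eq_inner flip: y_def) (simp add: power2_eq_square power4_eq_xxxx mult.assoc)
  then have "(norm (adjoint A (A x) - m\<^sup>2 *\<^sub>R x))\<^sup>2 \<le> 0"
    using sq by simp
  then have "adjoint A (A x) = m\<^sup>2 *\<^sub>R x"
    by simp
  moreover have "x \<noteq> 0" "sqrt (m\<^sup>2) = m"
    using x(1) by (auto simp: m_def)
  ultimately show ?thesis
    unfolding m singular_values_def by (metis (mono_tags, lifting) mem_Collect_eq)
qed

lemma largest_singular_value_eq_onorm:
  fixes A :: "'a::euclidean_space \<Rightarrow> 'b::euclidean_space"
  assumes "linear A"
  shows "largest_singular_value A = onorm A"
  unfolding largest_singular_value_def
proof (rule Max_eqI)
  show "finite (singular_values A)" "onorm A \<in> singular_values A"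
    by (rule finite_singular_values[OF assms], rule onorm_in_singular_values[OF assms])
  fix s assume "s \<in> singular_values A"
  then obtain l x where lx: "s = sqrt l" "x \<noteq> 0" "adjoint A (A x) = l *\<^sub>R x"
    unfolding singular_values_def by auto
  have "l * (norm x)\<^sup>2 = x \<bullet> adjoint A (A x)"
    using lx by (simp add: power2_norm_eq_inner)
  also have "\<dots> = (norm (A x))\<^sup>2"
    by (simp add: power2_norm_eq_inner adjoint_clauses[OF assms])
  also have "\<dots> \<le> (onorm A * norm x)\<^sup>2"
    using assms by (intro power_mono onorm) (auto simp: linear_conv_bounded_linear)
  finally have "l \<le> (onorm A)\<^sup>2"
    using lx(2) by (simp add: power_mult_distrib)
  then show "s \<le> onorm A"
    using lx(1) onorm_pos_le[of A] assms
    by (simp add: real_le_lsqrt linear_conv_bounded_linear)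
qed


section \<open>The nested primal-dual algorithm\<close>

text \<open>\<open>u n\<close> is the outer iterate \<open>u\<^sub>n\<close>, and \<open>U n k\<close>, \<open>V n k\<close> are the inner iterates with outer
  index \<open>n\<close> (subscript) and inner index \<open>k\<close> (superscript). The entries \<open>U n k\<close>, \<open>V n k\<close> with
  \<open>k > kmax\<close> are unconstrained and never used.\<close>

definition nested_primal_dual ::
  "('a::euclidean_space \<Rightarrow> 'a) \<Rightarrow> ('b::euclidean_space \<Rightarrow> ereal) \<Rightarrow> ('a \<Rightarrow> ereal) \<Rightarrow> ('a \<Rightarrow> 'b) \<Rightarrow>
   real \<Rightarrow> real \<Rightarrow> nat \<Rightarrow> (nat \<Rightarrow> 'a) \<Rightarrow> (nat \<Rightarrow> nat \<Rightarrow> 'a) \<Rightarrow> (nat \<Rightarrow> nat \<Rightarrow> 'b) \<Rightarrow> bool" where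
  "nested_primal_dual grad_f g h A \<alpha> \<beta> kmax u U V \<longleftrightarrow>
     (\<forall>n.
        (n > 0 \<longrightarrow> V n 0 = V (n - 1) kmax) \<and>
        (\<forall>k<kmax.
           U n k = prox (\<lambda>x. ereal \<alpha> * h x) (u n - \<alpha> *\<^sub>R grad_f (u n) - \<alpha> *\<^sub>R adjoint A (V n k)) \<and>
           V n (Suc k) =
             prox (\<lambda>w. ereal (\<beta> / \<alpha>) * fenchel_dual g w) (V n k + (\<beta> / \<alpha>) *\<^sub>R A (U n k))) \<and>
        U n kmax =
          prox (\<lambda>x. ereal \<alpha> * h x) (u n - \<alpha> *\<^sub>R grad_f (u n) - \<alpha> *\<^sub>R adjoint A (V n kmax)) \<and>
        u (Suc n) = (1 / real kmax) *\<^sub>R (\<Sum>k=1..kmax. U n k))"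

definition converges_linearly :: "(nat \<Rightarrow> 'a::real_normed_vector) \<Rightarrow> 'a \<Rightarrow> bool" where
  "converges_linearly x l \<longleftrightarrow>
     x \<longlonglongrightarrow> l \<and> (\<exists>C q. 0 \<le> q \<and> q < 1 \<and> (\<forall>n. norm (x n - l) \<le> C * q ^ n))"

end

theory Submission
  imports Defs
begin

text \<open>With \<open>h = 0\<close> the algorithm alternates a gradient step \<open>T x = x - \<alpha> \<nabla>f(x)\<close>, corrected by
  \<open>- \<alpha> A\<^sup>T v\<close>, with a dual step through \<open>P = prox\<close> of \<open>(\<beta>/\<alpha>) g\<^sup>*\<close>. The estimate behind everything
  compares two runs of the same algorithm, not a run with a solution.

  Let \<open>w\<close> be the difference of the two gradient steps, and \<open>e\<close>, \<open>e'\<close> the differences of the dual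
  variables before and after one inner step. Because \<open>P\<close> is firmly nonexpansive,
  \<open>|e'|\<^sup>2 \<le> \<langle>e', M e\<rangle> + (\<beta>/\<alpha>) \<langle>A\<^sup>T e', w\<rangle>\<close> with \<open>M = I - \<beta> A A\<^sup>T\<close>. The step size bound makes \<open>M\<close>
  positive semidefinite, so \<open>2 \<langle>e', M e\<rangle> \<le> \<langle>e', M e'\<rangle> + \<langle>e, M e\<rangle>\<close>; coercivity of \<open>A\<^sup>T\<close> gives
  \<open>\<langle>e, M e\<rangle> \<le> (1 - \<beta>\<sigma>\<^sup>2) |e|\<^sup>2\<close>; and the mixed term is absorbed by expanding \<open>|w - \<alpha> A\<^sup>T e'|\<^sup>2\<close>, the
  squared difference of the new primal points. The result is \<open>primal_dual_step_contracts\<close>: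
  \<open>\<beta> |w - \<alpha> A\<^sup>T e'|\<^sup>2 + \<alpha>\<^sup>2 |e'|\<^sup>2 \<le> \<beta> |w|\<^sup>2 + (1 - \<beta>\<sigma>\<^sup>2) \<alpha>\<^sup>2 |e|\<^sup>2\<close>.
  Summing over the inner loop telescopes the dual terms, and convexity of the squared norm passes
  from the primal points to their average (\<open>nested_loop_contracts\<close>). Finally \<open>|w|\<^sup>2\<close> is at most
  \<open>1 - \<alpha>(2 - \<alpha>L)\<mu> < 1\<close> times the squared distance of the primal points, by cocoercivity of the gradient
  together with strong convexity (\<open>gradient_step_contracts\<close>). Hence one outer iteration contracts
  the weighted distance by the larger of \<open>1 - \<alpha>(2 - \<alpha>L)\<mu>\<close> and \<open>1 - \<beta>\<sigma>\<^sup>2\<close>.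

  Since two arbitrary runs are compared, the same inequality, used with a single inner step, also
  gives existence: Banach's theorem yields a fixed point \<open>(u_hat, v_hat)\<close>. There
  \<open>\<nabla>f(u_hat) = - A\<^sup>T v_hat\<close>, and \<open>v_hat\<close> is a subgradient of \<open>g\<close> at \<open>A u_hat\<close>, so the objective
  exceeds its value at \<open>u_hat\<close> by at least \<open>\<mu>/2\<close> times the squared distance to \<open>u_hat\<close>:
  this is existence and uniqueness of the minimizer at once.

  The conjugate \<open>g\<^sup>*\<close> is accessed through Moreau's decomposition (\<open>prox_dual_subgradient\<close>),
  which expresses its proximal operator through a proximal point of \<open>g\<close> itself.\<close>

section \<open>Existence of proximal points\<close>

lemma open_superlevel_lsc:
  fixes p :: "'a::metric_space \<Rightarrow> ereal"
  assumes "lower_semicontinuous p"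
  shows "open {x. c < p x}"
proof (subst open_subopen, intro ballI)
  fix x assume "x \<in> {x. c < p x}"
  then have x: "c < p x" by simp
  also have "p x \<le> Liminf (at x) p"
    using assms by (simp add: lower_semicontinuous_def)
  finally have "eventually (\<lambda>y. c < p y) (at x)"
    by (rule less_LiminfD)
  then obtain S where S: "open S" "x \<in> S" "\<And>y. y \<in> S \<Longrightarrow> y \<noteq> x \<Longrightarrow> c < p y"
    unfolding eventually_at_topological by blast
  then have "S \<subseteq> {x. c < p x}" using x by auto
  with S show "\<exists>T. open T \<and> x \<in> T \<and> T \<subseteq> {x. c < p x}" by blast
qed

text \<open>A sum exceeds \<open>c\<close> exactly when some real \<open>r\<close> separates the two summands, which writes the
  superlevel set as a union of open sets.\<close>
lemma open_superlevel_add_continuous: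
  fixes p :: "'a::metric_space \<Rightarrow> ereal"
  assumes p: "\<And>c. open {x. c < p x}" and q: "continuous_on UNIV q"
  shows "open {x. c < p x + ereal (q x)}"
proof -
  have iff: "c < p x + ereal (q x) \<longleftrightarrow> (\<exists>r. ereal r < p x \<and> c < ereal (r + q x))" for x
  proof
    assume "c < p x + ereal (q x)"
    then have "c - ereal (q x) < p x"
      by (cases c; cases "p x") auto
    then obtain r where r: "c - ereal (q x) < ereal r" "ereal r < p x"
      using ereal_dense2 by blast
    then have "c < ereal (r + q x)" by (cases c) auto
    with r show "\<exists>r. ereal r < p x \<and> c < ereal (r + q x)" by blast
  next
    assume "\<exists>r. ereal r < p x \<and> c < ereal (r + q x)"
    then obtain r where "ereal r < p x" "c < ereal (r + q x)" by blast
    then show "c < p x + ereal (q x)"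
      by (cases "p x"; cases c) auto
  qed
  have "{x. c < p x + ereal (q x)} = (\<Union>r. {x. ereal r < p x} \<inter> {x. c < ereal (r + q x)})"
    using iff by auto
  moreover have "open {x. c < ereal (r + q x)}" for r
    by (intro open_Collect_less continuous_on_const continuous_on_ereal continuous_on_add q)
  ultimately show ?thesis using p by (simp add: open_Int open_UN)
qed

text \<open>If no point of \<open>C\<close> were minimal, the open sets \<open>{x. p y < p x}\<close> for \<open>y \<in> C\<close> would cover \<open>C\<close>; in a
  finite subcover, the \<open>y\<close> with the least value is covered by none of the sets.\<close>
lemma compact_attains_min_superlevel:
  fixes p :: "'a::metric_space \<Rightarrow> ereal"
  assumes p: "\<And>c. open {x. c < p x}" and "compact C" "C \<noteq> {}"
  obtains x where "x \<in> C" "\<And>y. y \<in> C \<Longrightarrow> p x \<le> p y"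
proof (rule ccontr)
  assume no: "\<not> thesis"
  then have ex: "\<And>x. x \<in> C \<Longrightarrow> \<exists>y\<in>C. p y < p x"
    using that by (meson not_le)
  have "C \<subseteq> \<Union> ((\<lambda>y. {x. p y < p x}) ` C)" using ex by auto
  then obtain D where D: "D \<subseteq> C" "finite D" "C \<subseteq> \<Union> ((\<lambda>y. {x. p y < p x}) ` D)"
    using compactE_image[OF \<open>compact C\<close>, of C "\<lambda>y. {x. p y < p x}"] p by metis
  then have "D \<noteq> {}" using \<open>C \<noteq> {}\<close> by auto
  then obtain m where m: "m \<in> D" "\<And>y. y \<in> D \<Longrightarrow> p m \<le> p y"
    using \<open>finite D\<close> finite_imageI[of D p] Min_in[of "p ` D"] Min_le[of "p ` D"]
    by (metis (no_types, lifting) image_iff image_is_empty)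
  then obtain y where "y \<in> D" "p y < p m" using D by auto
  with m(2) show False by (meson not_le)
qed

text \<open>On the unit ball around a point \<open>x0\<close> of the domain, \<open>g\<close> is bounded below by its minimum. By
  convexity, a value at \<open>x\<close> too far below \<open>g x0\<close>, relative to the distance from \<open>x0\<close>, would pull \<open>g\<close>
  below that minimum at the point where the segment from \<open>x\<close> to \<open>x0\<close> enters the ball. A bound that
  decays linearly is enough to make \<open>g\<close> plus a quadratic coercive.\<close>
lemma convex_lsc_linear_lower_bound:
  fixes g :: "'b::euclidean_space \<Rightarrow> ereal"
  assumes "proper g" "convex_ereal g" "lower_semicontinuous g"
  obtains x0 b c where "g x0 = ereal b" "c \<ge> 0" "\<And>x. g x \<ge> ereal (b - c * (1 + norm (x - x0)))"
proof -
  obtain x0 where "g x0 \<noteq> \<infinity>" and ninf: "\<And>x. g x \<noteq> -\<infinity>"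
    using assms(1) by (auto simp: proper_def)
  then obtain b where b: "g x0 = ereal b"
    by (cases "g x0") auto
  obtain x1 where x1: "x1 \<in> cball x0 1" "\<And>y. y \<in> cball x0 1 \<Longrightarrow> g x1 \<le> g y"
    using compact_attains_min_superlevel[OF open_superlevel_lsc[OF assms(3)], of "cball x0 1"]
    by auto
  obtain m where m: "g x1 = ereal m"
    using x1(2)[of x0] b ninf[of x1] by (cases "g x1") auto
  have mb: "m \<le> b" using x1(2)[of x0] b m by auto
  have "g x \<ge> ereal (b - (b - m) * (1 + norm (x - x0)))" for x
  proof (cases "norm (x - x0) \<le> 1")
    case True
    then have "ereal m \<le> g x" using x1(2)[of x] m by (auto simp: dist_norm norm_minus_commute)
    moreover have "b - (b - m) * (1 + norm (x - x0)) \<le> m"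
      using mb mult_nonneg_nonneg[of "b - m" "norm (x - x0)"] by (simp add: algebra_simps)
    ultimately show ?thesis by (meson ereal_less_eq(3) order_trans)
  next
    case False
    \<comment> \<open>\<open>x0 + (x - x0) / r\<close> is the point where the segment from \<open>x0\<close> to \<open>x\<close> leaves the unit ball\<close>
    define r where "r = norm (x - x0)"
    have r: "r > 1" using False by (simp add: r_def)
    define t where "t = 1 / r"
    have t: "0 < t" "t < 1" using r by (auto simp: t_def)
    have "(1 - t) *\<^sub>R x0 + t *\<^sub>R x = x0 + t *\<^sub>R (x - x0)" by (simp add: algebra_simps)
    moreover have "norm (t *\<^sub>R (x - x0)) = 1" using r t by (simp add: t_def r_def[symmetric])
    ultimately have "(1 - t) *\<^sub>R x0 + t *\<^sub>R x \<in> cball x0 1" by (simp add: dist_norm)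
    then have "ereal m \<le> g ((1 - t) *\<^sub>R x0 + t *\<^sub>R x)" using x1(2) m by metis
    also have "\<dots> \<le> ereal (1 - t) * g x0 + ereal t * g x"
      using assms(2) t by (auto simp: convex_ereal_def)
    finally have *: "ereal m \<le> ereal (1 - t) * g x0 + ereal t * g x" .
    show ?thesis
    proof (cases "g x")
      case (real y)
      then have "m \<le> (1 - t) * b + t * y" using * b by simp
      then have "r * m \<le> r * ((1 - t) * b + t * y)" using r by (intro mult_left_mono) auto
      also have "\<dots> = (r - 1) * b + y" using r by (simp add: t_def field_simps)
      finally have "b - (b - m) * r \<le> y" by (simp add: algebra_simps)
      then have "b - (b - m) * (1 + r) \<le> y" using mb by (simp add: algebra_simps)
      then show ?thesis using real by (simp add: r_def)
    next
      case MInf then show ?thesis using ninf by auto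
    qed auto
  qed
  then show ?thesis using that[of x0 b "b - m"] b mb by auto
qed

text \<open>The quadratic beats the linear lower bound outside a large ball, and inside it compactness
  applies.\<close>
lemma proximal_point_exists:
  fixes g :: "'b::euclidean_space \<Rightarrow> ereal"
  assumes g: "proper g" "convex_ereal g" "lower_semicontinuous g" and "\<tau> > 0"
  obtains p where "\<And>x. g p + ereal (\<tau> / 2 * (norm (p - a))\<^sup>2) \<le> g x + ereal (\<tau> / 2 * (norm (x - a))\<^sup>2)"
proof -
  obtain x0 b c where b: "g x0 = ereal b" and c: "c \<ge> 0"
    and lb: "\<And>x. g x \<ge> ereal (b - c * (1 + norm (x - x0)))"
    using convex_lsc_linear_lower_bound[OF g] by metis
  define G where "G x = g x + ereal (\<tau> / 2 * (norm (x - a))\<^sup>2)" for x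
  define s where "s = norm (x0 - a)"
  define D where "D = c * (1 + s) + \<tau> / 2 * s\<^sup>2"
  have D: "D \<ge> 0" using c \<open>\<tau> > 0\<close> by (simp add: D_def s_def)
  \<comment> \<open>\<open>R\<close> is large enough that outside \<open>cball a R\<close> the lower bound of the objective is at
    least its value at \<open>x0\<close>, and \<open>x0\<close> itself lies in the ball\<close>
  define R where "R = max s (max 1 (2 * (c + D) / \<tau>))"
  have "continuous_on UNIV (\<lambda>x. \<tau> / 2 * (norm (x - a))\<^sup>2)"
    by (intro continuous_intros)
  from open_superlevel_add_continuous[OF open_superlevel_lsc[OF g(3)] this]
  have "open {x. c < G x}" for c unfolding G_def .
  moreover have x0: "x0 \<in> cball a R" by (simp add: R_def s_def dist_norm norm_minus_commute)
  ultimately obtain p where p: "p \<in> cball a R" "\<And>y. y \<in> cball a R \<Longrightarrow> G p \<le> G y"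
    using compact_attains_min_superlevel[of G "cball a R"] by (metis compact_cball empty_iff)
  have "G p \<le> G x" for x
  proof (cases "x \<in> cball a R")
    case True then show ?thesis by (rule p(2))
  next
    case False
    define r where "r = norm (x - a)"
    have "r > R" using False by (simp add: r_def dist_norm norm_minus_commute)
    then have r: "r \<ge> 1" "r * \<tau> \<ge> 2 * (c + D)" using \<open>\<tau> > 0\<close>
      by (auto simp: R_def field_simps)
    have "norm (x - x0) \<le> r + s"
      unfolding r_def s_def by (metis norm_triangle_ineq4 diff_diff_eq2 diff_add_cancel)
    then have "c * (1 + norm (x - x0)) \<le> c * (1 + (r + s))" using c by (intro mult_left_mono) auto
    moreover have "r * (r * \<tau>) \<ge> r * (2 * (c + D))" using r by (intro mult_left_mono) auto
    moreover have "r * D \<ge> D" using r D mult_right_mono[of 1 r D] by simp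
    ultimately have "b + \<tau> / 2 * s\<^sup>2 \<le> b - c * (1 + norm (x - x0)) + \<tau> / 2 * r\<^sup>2"
      unfolding D_def by (simp add: algebra_simps power2_eq_square)
    then have "G x0 \<le> ereal (b - c * (1 + norm (x - x0))) + ereal (\<tau> / 2 * r\<^sup>2)"
      by (simp add: G_def b s_def)
    also have "\<dots> \<le> G x" unfolding G_def r_def by (intro add_right_mono lb)
    finally show ?thesis using p(2)[OF x0] by simp
  qed
  then show ?thesis using that unfolding G_def by blast
qed

section \<open>Subgradients and Moreau's decomposition\<close>

definition subgradient :: "('a::real_inner \<Rightarrow> ereal) \<Rightarrow> 'a \<Rightarrow> 'a \<Rightarrow> bool" where
  "subgradient g x w \<longleftrightarrow> (\<forall>y. g x + ereal (w \<bullet> (y - x)) \<le> g y)"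

text \<open>The subgradient inequality at any point of the domain forces \<open>g x\<close> to be finite.\<close>
lemma subgradient_finite:
  assumes "proper g" "subgradient g x w"
  obtains r where "g x = ereal r"
proof -
  obtain y where "g y \<noteq> \<infinity>" "g x \<noteq> -\<infinity>"
    using assms(1) by (auto simp: proper_def)
  moreover have "g x + ereal (w \<bullet> (y - x)) \<le> g y"
    using assms(2) by (simp add: subgradient_def)
  ultimately show ?thesis using that by (cases "g x") auto
qed

lemma nonpos_if_le_small_multiples:
  fixes a b :: real
  assumes "\<And>t. 0 < t \<Longrightarrow> t < 1 \<Longrightarrow> a \<le> t * b" "b \<ge> 0"
  shows "a \<le> 0"
proof (rule ccontr)
  assume "\<not> a \<le> 0"
  then have "a > 0" by simp
  then have "a \<le> a / (a + b + 1) * b" using assms(2) by (intro assms(1)) (auto simp: field_simps)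
  then have "a * (a + b + 1) \<le> a * b" using \<open>a > 0\<close> assms(2) by (simp add: field_simps)
  then show False using \<open>a > 0\<close> by (simp add: mult_le_cancel_left)
qed

text \<open>Comparing \<open>p\<close> with \<open>p + t (x - p)\<close> and using convexity, the quadratic contributes its derivative
  at order \<open>t\<close> and an error of order \<open>t\<^sup>2\<close>; dividing by \<open>t\<close> and letting \<open>t\<close> tend to \<open>0\<close> leaves the
  subgradient inequality.\<close>
lemma proximal_point_subgradient:
  fixes g :: "'b::euclidean_space \<Rightarrow> ereal"
  assumes g: "proper g" "convex_ereal g"
    and p: "\<And>x. g p + ereal (\<tau> / 2 * (norm (p - a))\<^sup>2) \<le> g x + ereal (\<tau> / 2 * (norm (x - a))\<^sup>2)"
    and "\<tau> > 0"
  shows "subgradient g p (\<tau> *\<^sub>R (a - p))"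
  unfolding subgradient_def
proof
  fix x
  have ninf: "\<And>x. g x \<noteq> -\<infinity>" using g by (auto simp: proper_def)
  obtain x0 where "g x0 \<noteq> \<infinity>" using g by (auto simp: proper_def)
  then obtain r where r: "g p = ereal r"
    using p[of x0] ninf[of p] by (cases "g p"; cases "g x0") auto
  show "g p + ereal (\<tau> *\<^sub>R (a - p) \<bullet> (x - p)) \<le> g x"
  proof (cases "g x")
    case (real s)
    have "r + \<tau> * ((a - p) \<bullet> (x - p)) - s \<le> t * (\<tau> / 2 * (norm (x - p))\<^sup>2)" if t: "0 < t" "t < 1" for t
    proof -
      define z where "z = (1 - t) *\<^sub>R p + t *\<^sub>R x"
      have z: "z - a = (p - a) + t *\<^sub>R (x - p)" by (simp add: z_def algebra_simps)
      have n: "(norm (z - a))\<^sup>2 = (norm (p - a))\<^sup>2 - 2 * t * ((a - p) \<bullet> (x - p)) + t * t * (norm (x - p))\<^sup>2"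
        unfolding z power2_norm_eq_inner
        by (simp add: inner_add_left inner_add_right inner_diff_left inner_diff_right inner_commute algebra_simps)
      have "g z \<le> ereal (1 - t) * g p + ereal t * g x"
        using g(2) t by (auto simp: convex_ereal_def z_def)
      then have "g z \<le> ereal ((1 - t) * r + t * s)" using r real by simp
      with p[of z] r have "r + \<tau> / 2 * (norm (p - a))\<^sup>2 \<le> (1 - t) * r + t * s + \<tau> / 2 * (norm (z - a))\<^sup>2"
        by (cases "g z") auto
      then have "t * (r + \<tau> * ((a - p) \<bullet> (x - p)) - s) \<le> t * (t * (\<tau> / 2 * (norm (x - p))\<^sup>2))"
        unfolding n by (simp add: algebra_simps)
      then show ?thesis using t by simp
    qed
    then have "r + \<tau> * ((a - p) \<bullet> (x - p)) - s \<le> 0"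
      using \<open>\<tau> > 0\<close> by (intro nonpos_if_le_small_multiples[where b = "\<tau> / 2 * (norm (x - p))\<^sup>2"]) auto
    then show ?thesis using r real by simp
  qed (use ninf in auto)
qed

text \<open>As \<open>prox\<close> is a choice among minimizers, its value is known once the minimizer is strict.\<close>
lemma prox_eqI:
  assumes "\<And>x. x \<noteq> w \<Longrightarrow>
    ereal (1 / 2 * (norm (w - a))\<^sup>2) + p w < ereal (1 / 2 * (norm (x - a))\<^sup>2) + p x"
  shows "prox p a = w"
  unfolding prox_def arg_min_def
  by (rule some_equality) (use assms in \<open>auto simp: is_arg_min_def dest: less_asym\<close>)

lemma prox_zero: "prox (\<lambda>x. ereal \<alpha> * ereal 0) a = a"
  by (rule prox_eqI) auto

text \<open>If \<open>w\<close> is a subgradient of \<open>g\<close> at \<open>p\<close>, the supremum defining \<open>g\<^sup>*(w)\<close> is attained at \<open>p\<close>, while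
  \<open>\<langle>x, p\<rangle> - g p\<close> bounds \<open>g\<^sup>*(x)\<close> from below for every \<open>x\<close>. Thus \<open>p\<close> is a subgradient of \<open>g\<^sup>*\<close> at \<open>w\<close>,
  which is the optimality condition of the proximal problem centred at \<open>w + \<tau> p\<close>.\<close>
lemma prox_dual_eqI:
  fixes g :: "'b::euclidean_space \<Rightarrow> ereal"
  assumes g: "proper g" and sub: "subgradient g p w" and "\<tau> > 0"
  shows "prox (\<lambda>w. ereal \<tau> * fenchel_dual g w) (w + \<tau> *\<^sub>R p) = w"
proof (rule prox_eqI)
  fix x assume "x \<noteq> w"
  obtain r where r: "g p = ereal r" using subgradient_finite[OF g sub] .
  have "fenchel_dual g w \<le> ereal (w \<bullet> p - r)"
    unfolding fenchel_dual_def
  proof (rule SUP_least)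
    fix y
    have "g p + ereal (w \<bullet> (y - p)) \<le> g y" using sub by (simp add: subgradient_def)
    then show "ereal (w \<bullet> y) - g y \<le> ereal (w \<bullet> p - r)"
      using r by (cases "g y") (auto simp: inner_diff_right)
  qed
  then have le: "ereal \<tau> * fenchel_dual g w \<le> ereal (\<tau> * (w \<bullet> p - r))"
    using \<open>\<tau> > 0\<close> ereal_mult_left_mono[of "fenchel_dual g w" "ereal (w \<bullet> p - r)" "ereal \<tau>"] by simp
  have "ereal (x \<bullet> p) - g p \<le> fenchel_dual g x"
    unfolding fenchel_dual_def by (rule SUP_upper) simp
  then have ge: "ereal (\<tau> * (x \<bullet> p - r)) \<le> ereal \<tau> * fenchel_dual g x"
    using \<open>\<tau> > 0\<close> r ereal_mult_left_mono[of "ereal (x \<bullet> p - r)" "fenchel_dual g x" "ereal \<tau>"] by simp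
  have "(norm (x - (w + \<tau> *\<^sub>R p)))\<^sup>2 = (norm (x - w))\<^sup>2 - 2 * (\<tau> * (x \<bullet> p)) + 2 * (\<tau> * (w \<bullet> p)) + (norm (w - (w + \<tau> *\<^sub>R p)))\<^sup>2"
    unfolding power2_norm_eq_inner
    by (simp add: inner_add_left inner_add_right inner_diff_left inner_diff_right inner_commute algebra_simps)
  moreover have "(norm (x - w))\<^sup>2 > 0" using \<open>x \<noteq> w\<close> by simp
  ultimately have "1 / 2 * (norm (w - (w + \<tau> *\<^sub>R p)))\<^sup>2 + \<tau> * (w \<bullet> p - r)
      < 1 / 2 * (norm (x - (w + \<tau> *\<^sub>R p)))\<^sup>2 + \<tau> * (x \<bullet> p - r)"
    unfolding right_diff_distrib by linarith
  then have "ereal (1 / 2 * (norm (w - (w + \<tau> *\<^sub>R p)))\<^sup>2) + ereal (\<tau> * (w \<bullet> p - r))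
      < ereal (1 / 2 * (norm (x - (w + \<tau> *\<^sub>R p)))\<^sup>2) + ereal (\<tau> * (x \<bullet> p - r))" by simp
  then show "ereal (1 / 2 * (norm (w - (w + \<tau> *\<^sub>R p)))\<^sup>2) + ereal \<tau> * fenchel_dual g w
      < ereal (1 / 2 * (norm (x - (w + \<tau> *\<^sub>R p)))\<^sup>2) + ereal \<tau> * fenchel_dual g x"
    using add_left_mono[OF le] add_left_mono[OF ge] by (meson le_less_trans less_le_trans)
qed

text \<open>Moreau's decomposition \<open>a = P a + \<tau> p\<close>, where \<open>p\<close> is the proximal point of \<open>g / \<tau>\<close> at \<open>a / \<tau>\<close>. It
  supplies the existence of the dual proximal point, and it identifies \<open>P a\<close> as a subgradient of \<open>g\<close>.\<close>
lemma prox_dual_subgradient: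
  fixes g :: "'b::euclidean_space \<Rightarrow> ereal"
  assumes g: "proper g" "convex_ereal g" "lower_semicontinuous g" and "\<tau> > 0"
  defines "P \<equiv> prox (\<lambda>w. ereal \<tau> * fenchel_dual g w)"
  shows "subgradient g ((1 / \<tau>) *\<^sub>R (a - P a)) (P a)"
proof -
  obtain p where p: "\<And>x. g p + ereal ((\<tau>) / 2 * (norm (p - (1 / \<tau>) *\<^sub>R a))\<^sup>2)
      \<le> g x + ereal (\<tau> / 2 * (norm (x - (1 / \<tau>) *\<^sub>R a))\<^sup>2)"
    using proximal_point_exists[OF g \<open>\<tau> > 0\<close>, of "(1 / \<tau>) *\<^sub>R a"] by blast
  define w where "w = \<tau> *\<^sub>R ((1 / \<tau>) *\<^sub>R a - p)"
  have w: "subgradient g p w"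
    unfolding w_def by (rule proximal_point_subgradient[OF g(1,2) p \<open>\<tau> > 0\<close>])
  have a: "a = w + \<tau> *\<^sub>R p" using \<open>\<tau> > 0\<close> by (simp add: w_def algebra_simps)
  have "P a = w"
    unfolding P_def a by (rule prox_dual_eqI[OF g(1) w \<open>\<tau> > 0\<close>])
  then show ?thesis using w a \<open>\<tau> > 0\<close> by simp
qed

lemma subgradient_monotone:
  assumes "proper g" "subgradient g x v" "subgradient g y w"
  shows "(v - w) \<bullet> (x - y) \<ge> 0"
proof -
  obtain r s where r: "g x = ereal r" and s: "g y = ereal s"
    using subgradient_finite[OF assms(1,2)] subgradient_finite[OF assms(1,3)] by metis
  have "g x + ereal (v \<bullet> (y - x)) \<le> g y" "g y + ereal (w \<bullet> (x - y)) \<le> g x"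
    using assms by (auto simp: subgradient_def)
  then show ?thesis using r s by (simp add: inner_diff_left inner_diff_right)
qed

lemma prox_dual_firmly_nonexpansive:
  fixes g :: "'b::euclidean_space \<Rightarrow> ereal"
  assumes g: "proper g" "convex_ereal g" "lower_semicontinuous g" and "\<tau> > 0"
  defines "P \<equiv> prox (\<lambda>w. ereal \<tau> * fenchel_dual g w)"
  shows "(norm (P a - P b))\<^sup>2 \<le> (P a - P b) \<bullet> (a - b)"
proof -
  have "0 \<le> (P a - P b) \<bullet> ((1 / \<tau>) *\<^sub>R (a - P a) - (1 / \<tau>) *\<^sub>R (b - P b))"
    unfolding P_def by (intro subgradient_monotone[OF g(1)] prox_dual_subgradient assms)
  also have "\<dots> = (1 / \<tau>) * ((P a - P b) \<bullet> (a - b) - (norm (P a - P b))\<^sup>2)"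
    by (simp add: inner_diff_right inner_diff_left power2_norm_eq_inner algebra_simps diff_divide_distrib add_divide_distrib)
  finally show ?thesis using \<open>\<tau> > 0\<close> by (simp add: zero_le_mult_iff zero_le_divide_iff)
qed

section \<open>Contraction by a gradient step\<close>

lemma gderiv_along_line:
  assumes "\<And>x. GDERIV f x :> grad_f x"
  shows "((\<lambda>t. f (x + t *\<^sub>R d)) has_real_derivative (grad_f (x + t *\<^sub>R d) \<bullet> d)) (at t)"
proof -
  have "(f has_derivative (\<lambda>h. h \<bullet> grad_f (x + t *\<^sub>R d))) (at (x + t *\<^sub>R d))"
    using assms[of "x + t *\<^sub>R d"] by (simp add: gderiv_def)
  moreover have "((\<lambda>t. x + t *\<^sub>R d) has_derivative (\<lambda>h. h *\<^sub>R d)) (at t)"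
    by (auto intro!: derivative_eq_intros)
  ultimately have "((\<lambda>t. f (x + t *\<^sub>R d)) has_derivative (\<lambda>h. (h *\<^sub>R d) \<bullet> grad_f (x + t *\<^sub>R d))) (at t)"
    by (rule has_derivative_compose[rotated])
  then show ?thesis
    by (simp add: has_field_derivative_def inner_commute mult.commute[of _ "d \<bullet> _"] mult_commute_abs)
qed

text \<open>Along the segment, \<open>f\<close> minus the claimed quadratic upper bound has a nonpositive derivative,
  by Cauchy-Schwarz and the Lipschitz bound.\<close>
lemma descent_inequality:
  fixes f :: "'a::real_inner \<Rightarrow> real"
  assumes df: "\<And>x. GDERIV f x :> grad_f x" and lip: "L-lipschitz_on UNIV grad_f"
  shows "f (x + d) \<le> f x + grad_f x \<bullet> d + L / 2 * (norm d)\<^sup>2"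
proof -
  define \<phi> where "\<phi> t = f (x + t *\<^sub>R d) - t * (grad_f x \<bullet> d) - L / 2 * t\<^sup>2 * (norm d)\<^sup>2" for t
  have "(\<phi> has_real_derivative (grad_f (x + t *\<^sub>R d) \<bullet> d - grad_f x \<bullet> d - L * t * (norm d)\<^sup>2)) (at t)" for t
    unfolding \<phi>_def
    by (rule derivative_eq_intros gderiv_along_line[OF df] refl | simp)+
  moreover have "grad_f (x + t *\<^sub>R d) \<bullet> d - grad_f x \<bullet> d - L * t * (norm d)\<^sup>2 \<le> 0" if "t \<ge> 0" for t
  proof -
    have "(grad_f (x + t *\<^sub>R d) - grad_f x) \<bullet> d \<le> norm (grad_f (x + t *\<^sub>R d) - grad_f x) * norm d"
      by (rule norm_cauchy_schwarz)
    also have "\<dots> \<le> (L * norm (t *\<^sub>R d)) * norm d"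
      using lipschitz_onD[OF lip, of "x + t *\<^sub>R d" x] by (intro mult_right_mono) (auto simp: dist_norm)
    finally show ?thesis using that by (simp add: inner_diff_left power2_eq_square algebra_simps)
  qed
  ultimately have "\<phi> 1 \<le> \<phi> 0"
    by (intro DERIV_nonpos_imp_nonincreasing[of 0 1]) (use zero_le_one in blast)+
  then show ?thesis by (simp add: \<phi>_def)
qed

text \<open>The theorem of Baillon and Haddad. Subtracting the linearization at \<open>x\<close> from \<open>f\<close> leaves a convex
  function minimal at \<open>x\<close>; one gradient step of length \<open>1/L\<close> from \<open>y\<close> decreases it by at least
  \<open>1/(2L)\<close> times its squared gradient there, without passing below the minimum. Adding the
  estimates with \<open>x\<close> and \<open>y\<close> exchanged gives the claim.\<close>
lemma gradient_cocoercive: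
  fixes f :: "'a::real_inner \<Rightarrow> real"
  assumes df: "\<And>x. GDERIV f x :> grad_f x" and "L > 0" and lip: "L-lipschitz_on UNIV grad_f"
    and cvx: "\<And>x y. f y \<ge> f x + grad_f x \<bullet> (y - x)"
  shows "(norm (grad_f x - grad_f y))\<^sup>2 \<le> L * ((grad_f x - grad_f y) \<bullet> (x - y))"
proof -
  have half: "f x + grad_f x \<bullet> (y - x) + 1 / (2 * L) * (norm (grad_f x - grad_f y))\<^sup>2 \<le> f y" for x y
  proof -
    define G where "G = grad_f y - grad_f x"
    define z where "z = y + (- (1 / L)) *\<^sub>R G"
    have "f x + grad_f x \<bullet> (z - x) \<le> f z" by (rule cvx)
    also have "f z \<le> f y + grad_f y \<bullet> ((- (1 / L)) *\<^sub>R G) + L / 2 * (norm ((- (1 / L)) *\<^sub>R G))\<^sup>2"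
      unfolding z_def by (rule descent_inequality[OF df lip])
    also have "L / 2 * (norm ((- (1 / L)) *\<^sub>R G))\<^sup>2 = 1 / (2 * L) * (norm G)\<^sup>2"
      using \<open>L > 0\<close> by (simp add: power_mult_distrib power_divide) (simp add: power2_eq_square)
    finally have "f x + grad_f x \<bullet> (z - x) \<le> f y - (1 / L) * (grad_f y \<bullet> G) + 1 / (2 * L) * (norm G)\<^sup>2"
      by simp
    moreover have "grad_f x \<bullet> (z - x) = grad_f x \<bullet> (y - x) - (1 / L) * (grad_f x \<bullet> G)"
      by (simp add: z_def inner_diff_right inner_add_right)
    moreover have "grad_f y \<bullet> G - grad_f x \<bullet> G = (norm G)\<^sup>2"
      by (simp add: G_def power2_norm_eq_inner inner_diff_left)
    then have "(1 / L) * (grad_f y \<bullet> G) - (1 / L) * (grad_f x \<bullet> G) = 2 * (1 / (2 * L) * (norm G)\<^sup>2)"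
      by (simp add: diff_divide_distrib[symmetric])
    ultimately show ?thesis
      by (simp add: G_def norm_minus_commute)
  qed
  have "1 / L * (norm (grad_f x - grad_f y))\<^sup>2 \<le> (grad_f x - grad_f y) \<bullet> (x - y)"
    using half[of x y] half[of y x]
    by (simp add: inner_diff_left inner_diff_right norm_minus_commute[of "grad_f y"])
  then show ?thesis using \<open>L > 0\<close> by (simp add: field_simps)
qed

text \<open>In the expansion of the square, cocoercivity turns the quadratic term \<open>\<alpha>\<^sup>2 |G|\<^sup>2\<close> into a multiple of
  \<open>\<langle>G, d\<rangle>\<close>. The total coefficient \<open>- \<alpha> (2 - \<alpha> L)\<close> is negative for every step size below \<open>2/L\<close>, so
  strong monotonicity \<open>\<langle>G, d\<rangle> \<ge> \<mu> |d|\<^sup>2\<close> can be applied to what remains.\<close>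
lemma gradient_step_contracts:
  fixes f :: "'a::euclidean_space \<Rightarrow> real"
  assumes df: "\<And>x. GDERIV f x :> grad_f x" and "L > 0" and lip: "L-lipschitz_on UNIV grad_f"
    and "\<mu> > 0" and sc: "strongly_convex f grad_f \<mu>" and "0 < \<alpha>" "\<alpha> < 2 / L"
  shows "(norm ((x - \<alpha> *\<^sub>R grad_f x) - (y - \<alpha> *\<^sub>R grad_f y)))\<^sup>2
      \<le> (1 - \<alpha> * (2 - \<alpha> * L) * \<mu>) * (norm (x - y))\<^sup>2"
proof -
  define d where "d = x - y"
  define G where "G = grad_f x - grad_f y"
  have "f y \<ge> f x + grad_f x \<bullet> (y - x)" for x y
  proof -
    have "f y \<ge> f x + grad_f x \<bullet> (y - x) + \<mu> / 2 * (norm (y - x))\<^sup>2"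
      using sc unfolding strongly_convex_def by blast
    moreover have "\<mu> / 2 * (norm (y - x))\<^sup>2 \<ge> 0" using \<open>\<mu> > 0\<close> by simp
    ultimately show ?thesis by linarith
  qed
  then have coco: "(norm G)\<^sup>2 \<le> L * (G \<bullet> d)"
    unfolding G_def d_def by (rule gradient_cocoercive[OF df \<open>L > 0\<close> lip])
  have "f y \<ge> f x + grad_f x \<bullet> (y - x) + \<mu> / 2 * (norm (y - x))\<^sup>2"
       "f x \<ge> f y + grad_f y \<bullet> (x - y) + \<mu> / 2 * (norm (x - y))\<^sup>2"
    using sc unfolding strongly_convex_def by blast+
  then have mono: "\<mu> * (norm d)\<^sup>2 \<le> G \<bullet> d"
    by (simp add: d_def G_def inner_diff_left inner_diff_right norm_minus_commute[of y x])
  have pos: "\<alpha> * (2 - \<alpha> * L) \<ge> 0" using assms by (simp add: field_simps)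
  have "(norm (d - \<alpha> *\<^sub>R G))\<^sup>2 = (norm d)\<^sup>2 - 2 * \<alpha> * (G \<bullet> d) + \<alpha>\<^sup>2 * (norm G)\<^sup>2"
    unfolding power2_norm_eq_inner
    by (simp add: inner_diff_left inner_diff_right inner_commute power2_eq_square algebra_simps)
  also have "\<dots> \<le> (norm d)\<^sup>2 - 2 * \<alpha> * (G \<bullet> d) + \<alpha>\<^sup>2 * (L * (G \<bullet> d))"
    using coco by (intro add_left_mono mult_left_mono) auto
  also have "\<dots> = (norm d)\<^sup>2 - \<alpha> * (2 - \<alpha> * L) * (G \<bullet> d)"
    by (simp add: power2_eq_square algebra_simps)
  also have "\<dots> \<le> (norm d)\<^sup>2 - \<alpha> * (2 - \<alpha> * L) * (\<mu> * (norm d)\<^sup>2)"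
    using mult_left_mono[OF mono pos] by simp
  finally show ?thesis by (simp add: d_def G_def algebra_simps)
qed

section \<open>Contraction by the inner loop\<close>

lemma norm_adjoint_le:
  fixes A :: "'a::euclidean_space \<Rightarrow> 'b::euclidean_space"
  assumes "linear A"
  shows "norm (adjoint A y) \<le> onorm A * norm y"
proof (cases "adjoint A y = 0")
  case True
  then show ?thesis
    using onorm_pos_le[of A] assms by (simp add: linear_conv_bounded_linear)
next
  case False
  have "(norm (adjoint A y))\<^sup>2 = A (adjoint A y) \<bullet> y"
    by (simp add: power2_norm_eq_inner adjoint_clauses[OF assms])
  also have "\<dots> \<le> norm (A (adjoint A y)) * norm y"
    by (rule norm_cauchy_schwarz)
  also have "\<dots> \<le> (onorm A * norm (adjoint A y)) * norm y"
    using assms by (intro mult_right_mono onorm) (auto simp: linear_conv_bounded_linear)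
  finally show ?thesis
    using False by (simp add: power2_eq_square)
qed

text \<open>Here \<open>w\<close> is the difference of two gradient steps and \<open>e\<close>, \<open>e'\<close> the differences of the dual
  variables before and after one inner step, so that \<open>w - \<alpha> A\<^sup>T e'\<close> is the difference of the primal
  points computed from the new dual variables. The hypothesis \<open>firm\<close> is firm nonexpansiveness of the dual
  proximal operator, evaluated at the two arguments of the dual step.\<close>
lemma primal_dual_step_contracts:
  fixes A :: "'a::euclidean_space \<Rightarrow> 'b::euclidean_space"
  assumes A: "linear A" and "\<alpha> > 0" and "\<beta> > 0" and \<beta>: "\<beta> * (onorm A)\<^sup>2 \<le> 1"
    and coer: "\<And>v. norm (adjoint A v) \<ge> \<sigma> * norm v" and "\<sigma> > 0"
    and firm: "(norm e')\<^sup>2 \<le> e' \<bullet> (e + (\<beta> / \<alpha>) *\<^sub>R A (w - \<alpha> *\<^sub>R adjoint A e))"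
  shows "\<beta> * (norm (w - \<alpha> *\<^sub>R adjoint A e'))\<^sup>2 + \<alpha>\<^sup>2 * (norm e')\<^sup>2
      \<le> \<beta> * (norm w)\<^sup>2 + (1 - \<beta> * \<sigma>\<^sup>2) * (\<alpha>\<^sup>2 * (norm e)\<^sup>2)"
proof -
  define B where "B = adjoint A"
  have B: "linear B" unfolding B_def by (rule adjoint_linear[OF A])
  have adj: "x \<bullet> A y = B x \<bullet> y" for x y
    by (simp add: B_def adjoint_clauses[OF A])
  \<comment> \<open>\<open>M = I - \<beta> A A\<^sup>T\<close> is positive semidefinite\<close>
  have psd: "\<beta> * (norm (B x))\<^sup>2 \<le> (norm x)\<^sup>2" for x
  proof -
    have "\<beta> * (norm (B x))\<^sup>2 \<le> \<beta> * (onorm A * norm x)\<^sup>2"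
      using \<open>\<beta> > 0\<close> norm_adjoint_le[OF A, of x] unfolding B_def
      by (intro mult_left_mono power_mono) auto
    also have "\<dots> \<le> 1 * (norm x)\<^sup>2"
      unfolding power_mult_distrib mult.assoc[symmetric] using \<beta> by (intro mult_right_mono) auto
    finally show ?thesis by simp
  qed
  have "(norm e')\<^sup>2 \<le> e' \<bullet> e + \<beta> / \<alpha> * (B e' \<bullet> w) - \<beta> * (B e' \<bullet> B e)"
    using firm \<open>\<alpha> > 0\<close> unfolding B_def[symmetric]
    by (simp add: inner_add_right inner_diff_right adj right_diff_distrib)
  \<comment> \<open>the inequality \<open>2 \<langle>e', M e\<rangle> \<le> \<langle>e', M e'\<rangle> + \<langle>e, M e\<rangle>\<close>\<close>
  moreover have "2 * (e' \<bullet> e) - 2 * (\<beta> * (B e' \<bullet> B e))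
      \<le> (norm e')\<^sup>2 - \<beta> * (norm (B e'))\<^sup>2 + (norm e)\<^sup>2 - \<beta> * (norm (B e))\<^sup>2"
    using psd[of "e' - e"] unfolding power2_norm_eq_inner
    by (simp add: linear_diff[OF B] inner_diff_left inner_diff_right inner_commute algebra_simps)
  ultimately have "(norm e')\<^sup>2 + \<beta> * (norm (B e'))\<^sup>2 - 2 * (\<beta> / \<alpha> * (B e' \<bullet> w))
      \<le> (norm e)\<^sup>2 - \<beta> * (norm (B e))\<^sup>2" by linarith
  also have "\<dots> \<le> (norm e)\<^sup>2 - \<beta> * (\<sigma> * norm e)\<^sup>2"
    using \<open>\<beta> > 0\<close> \<open>\<sigma> > 0\<close> coer[of e] unfolding B_def
    by (intro diff_left_mono mult_left_mono power_mono) auto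
  finally have "\<alpha>\<^sup>2 * ((norm e')\<^sup>2 + \<beta> * (norm (B e'))\<^sup>2 - 2 * (\<beta> / \<alpha> * (B e' \<bullet> w)))
      \<le> \<alpha>\<^sup>2 * ((norm e)\<^sup>2 - \<beta> * (\<sigma> * norm e)\<^sup>2)"
    by (intro mult_left_mono) auto
  also have "\<alpha>\<^sup>2 * ((norm e')\<^sup>2 + \<beta> * (norm (B e'))\<^sup>2 - 2 * (\<beta> / \<alpha> * (B e' \<bullet> w)))
      = \<alpha>\<^sup>2 * (norm e')\<^sup>2 + \<beta> * (\<alpha>\<^sup>2 * (norm (B e'))\<^sup>2) - 2 * (\<alpha> * \<beta> * (B e' \<bullet> w))"
    using \<open>\<alpha> > 0\<close> by (simp add: power2_eq_square algebra_simps)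
  finally have *: "\<alpha>\<^sup>2 * (norm e')\<^sup>2 + \<beta> * (\<alpha>\<^sup>2 * (norm (B e'))\<^sup>2) - 2 * (\<alpha> * \<beta> * (B e' \<bullet> w))
      \<le> (1 - \<beta> * \<sigma>\<^sup>2) * (\<alpha>\<^sup>2 * (norm e)\<^sup>2)"
    by (simp add: power_mult_distrib algebra_simps)
  have "\<beta> * (norm (w - \<alpha> *\<^sub>R B e'))\<^sup>2
      = \<beta> * (norm w)\<^sup>2 - 2 * (\<alpha> * \<beta> * (B e' \<bullet> w)) + \<beta> * (\<alpha>\<^sup>2 * (norm (B e'))\<^sup>2)"
    unfolding power2_norm_eq_inner
    by (simp add: inner_diff_left inner_diff_right inner_commute power2_eq_square algebra_simps)
  with * show ?thesis unfolding B_def by linarith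
qed

text \<open>This keeps the dual contraction factor \<open>1 - \<beta>\<sigma>\<^sup>2\<close> nonnegative, and it excludes \<open>A = 0\<close>, for which a
  bound on \<open>\<beta>\<close> of the form \<open>1 / |A|\<^sup>2\<close> would be a division by zero.\<close>
lemma coercivity_le_onorm:
  fixes A :: "'a::euclidean_space \<Rightarrow> 'b::euclidean_space"
  assumes "linear A" "\<And>v. norm (adjoint A v) \<ge> \<sigma> * norm v"
  shows "\<sigma> \<le> onorm A"
proof -
  obtain b :: 'b where "b \<in> Basis" using nonempty_Basis by blast
  then show ?thesis
    using norm_adjoint_le[OF assms(1), of b] assms(2)[of b] by simp
qed

lemma norm_sum_squared_le:
  fixes x :: "'i \<Rightarrow> 'a::real_normed_vector"
  shows "(norm (\<Sum>i\<in>I. x i))\<^sup>2 \<le> real (card I) * (\<Sum>i\<in>I. (norm (x i))\<^sup>2)"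
proof -
  have "(norm (\<Sum>i\<in>I. x i))\<^sup>2 \<le> (\<Sum>i\<in>I. norm (x i))\<^sup>2"
    by (intro power_mono norm_sum) auto
  also have "\<dots> \<le> (\<Sum>i\<in>I. (norm (x i))\<^sup>2) * card I"
    by (rule sum_squared_le_sum_of_squares)
  finally show ?thesis by (simp add: mult.commute)
qed

text \<open>Summing the one-step estimate, the dual terms telescope up to the factor \<open>1 - \<beta>\<sigma>\<^sup>2 \<le> 1\<close>, which is
  kept only for the initial one. The primal terms sum up with a common bound, and the average of the primal
  points is controlled by the average of their squares. Dividing by \<open>K\<close> is what puts the weight
  \<open>1 / K\<close> on the dual variable.\<close>
lemma nested_loop_contracts:
  fixes A :: "'a::euclidean_space \<Rightarrow> 'b::euclidean_space" and e :: "nat \<Rightarrow> 'b"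
  assumes A: "linear A" and "\<alpha> > 0" and "\<beta> > 0" and \<beta>: "\<beta> * (onorm A)\<^sup>2 \<le> 1"
    and coer: "\<And>v. norm (adjoint A v) \<ge> \<sigma> * norm v" and "\<sigma> > 0" and "K \<ge> 1"
    and firm: "\<And>k. k < K \<Longrightarrow> (norm (e (Suc k)))\<^sup>2
      \<le> e (Suc k) \<bullet> (e k + (\<beta> / \<alpha>) *\<^sub>R A (w - \<alpha> *\<^sub>R adjoint A (e k)))"
  defines "d \<equiv> \<lambda>k. w - \<alpha> *\<^sub>R adjoint A (e k)"
  shows "\<beta> * (norm ((1 / real K) *\<^sub>R (\<Sum>k=1..K. d k)))\<^sup>2 + \<alpha>\<^sup>2 * (1 / real K) * (norm (e K))\<^sup>2
      \<le> \<beta> * (norm w)\<^sup>2 + (1 - \<beta> * \<sigma>\<^sup>2) * (\<alpha>\<^sup>2 * (1 / real K) * (norm (e 0))\<^sup>2)"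
proof -
  have step: "\<beta> * (norm (d (Suc k)))\<^sup>2 + \<alpha>\<^sup>2 * (norm (e (Suc k)))\<^sup>2
      \<le> \<beta> * (norm w)\<^sup>2 + (1 - \<beta> * \<sigma>\<^sup>2) * (\<alpha>\<^sup>2 * (norm (e k))\<^sup>2)" if "k < K" for k
    unfolding d_def
    by (rule primal_dual_step_contracts[OF A \<open>\<alpha> > 0\<close> \<open>\<beta> > 0\<close> \<beta> coer \<open>\<sigma> > 0\<close> firm[OF that]])
  have "n \<le> K \<Longrightarrow> \<beta> * (\<Sum>k=1..n. (norm (d k))\<^sup>2) + \<alpha>\<^sup>2 * (norm (e n))\<^sup>2
      \<le> real n * (\<beta> * (norm w)\<^sup>2) + (1 - \<beta> * \<sigma>\<^sup>2) * (\<alpha>\<^sup>2 * (norm (e 0))\<^sup>2)" if "n \<ge> 1" for n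
    using that
  proof (induction n rule: nat_induct_at_least)
    case base
    then show ?case using step[of 0] by simp
  next
    case (Suc n)
    have "(1 - \<beta> * \<sigma>\<^sup>2) * (\<alpha>\<^sup>2 * (norm (e n))\<^sup>2) \<le> 1 * (\<alpha>\<^sup>2 * (norm (e n))\<^sup>2)"
      using \<open>\<beta> > 0\<close> by (intro mult_right_mono) auto
    moreover have "(\<Sum>k=1..Suc n. (norm (d k))\<^sup>2) = (\<Sum>k=1..n. (norm (d k))\<^sup>2) + (norm (d (Suc n)))\<^sup>2"
      by simp
    ultimately show ?case
      using step[of n] Suc by (simp only: distrib_left distrib_right of_nat_Suc) linarith
  qed
  from this[of K] have sum: "\<beta> * (\<Sum>k=1..K. (norm (d k))\<^sup>2) + \<alpha>\<^sup>2 * (norm (e K))\<^sup>2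
      \<le> real K * (\<beta> * (norm w)\<^sup>2) + (1 - \<beta> * \<sigma>\<^sup>2) * (\<alpha>\<^sup>2 * (norm (e 0))\<^sup>2)"
    using \<open>K \<ge> 1\<close> by simp
  have "(norm ((1 / real K) *\<^sub>R (\<Sum>k=1..K. d k)))\<^sup>2 = 1 / real K * (1 / real K * (norm (\<Sum>k=1..K. d k))\<^sup>2)"
    by (simp add: power_mult_distrib power_divide power2_eq_square)
  also have "\<dots> \<le> 1 / real K * (\<Sum>k=1..K. (norm (d k))\<^sup>2)"
    using norm_sum_squared_le[of d "{1..K}"] \<open>K \<ge> 1\<close>
    by (intro mult_left_mono) (auto simp: field_simps)
  finally have "\<beta> * (norm ((1 / real K) *\<^sub>R (\<Sum>k=1..K. d k)))\<^sup>2
      \<le> \<beta> * (1 / real K * (\<Sum>k=1..K. (norm (d k))\<^sup>2))"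
    using \<open>\<beta> > 0\<close> by (intro mult_left_mono) auto
  then have "\<beta> * (norm ((1 / real K) *\<^sub>R (\<Sum>k=1..K. d k)))\<^sup>2 + \<alpha>\<^sup>2 * (1 / real K) * (norm (e K))\<^sup>2
      \<le> 1 / real K * (\<beta> * (\<Sum>k=1..K. (norm (d k))\<^sup>2) + \<alpha>\<^sup>2 * (norm (e K))\<^sup>2)"
    by (simp add: algebra_simps add_divide_distrib)
  also have "\<dots> \<le> 1 / real K * (real K * (\<beta> * (norm w)\<^sup>2) + (1 - \<beta> * \<sigma>\<^sup>2) * (\<alpha>\<^sup>2 * (norm (e 0))\<^sup>2))"
    using sum by (intro mult_left_mono) auto
  also have "\<dots> = \<beta> * (norm w)\<^sup>2 + (1 - \<beta> * \<sigma>\<^sup>2) * (\<alpha>\<^sup>2 * (1 / real K) * (norm (e 0))\<^sup>2)"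
    using \<open>K \<ge> 1\<close> by (simp add: field_simps)
  finally show ?thesis .
qed

section \<open>Fixed point, optimality and linear convergence\<close>

text \<open>Rescaling the factors by \<open>sqrt a\<close> and \<open>sqrt b\<close> turns the weighted distance into the metric of
  the product space, where Banach's theorem applies.\<close>
lemma weighted_contraction_fixed_point:
  fixes \<Phi> :: "'a::banach \<times> 'b::banach \<Rightarrow> 'a \<times> 'b"
  assumes "a > 0" "b > 0" "0 \<le> \<epsilon>" "\<epsilon> < 1"
    and contr: "\<And>y z. a * (norm (fst (\<Phi> y) - fst (\<Phi> z)))\<^sup>2 + b * (norm (snd (\<Phi> y) - snd (\<Phi> z)))\<^sup>2
      \<le> \<epsilon> * (a * (norm (fst y - fst z))\<^sup>2 + b * (norm (snd y - snd z))\<^sup>2)"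
  obtains z where "\<Phi> z = z"
proof -
  define S where "S z = (sqrt a *\<^sub>R fst z, sqrt b *\<^sub>R snd z)" for z :: "'a \<times> 'b"
  define S' where "S' z = ((1 / sqrt a) *\<^sub>R fst z, (1 / sqrt b) *\<^sub>R snd z)" for z :: "'a \<times> 'b"
  have inv: "S (S' z) = z" "S' (S z) = z" for z
    using assms by (auto simp: S_def S'_def)
  have dist: "(dist (S y) (S z))\<^sup>2 = a * (norm (fst y - fst z))\<^sup>2 + b * (norm (snd y - snd z))\<^sup>2" for y z
    using assms by (simp add: S_def dist_norm norm_Pair power_mult_distrib
        flip: scaleR_diff_right)
  have "dist (S (\<Phi> (S' y))) (S (\<Phi> (S' z))) \<le> sqrt \<epsilon> * dist y z" for y z
  proof (rule power2_le_imp_le)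
    show "(dist (S (\<Phi> (S' y))) (S (\<Phi> (S' z))))\<^sup>2 \<le> (sqrt \<epsilon> * dist y z)\<^sup>2"
      using contr[of "S' y" "S' z"] dist[of "S' y" "S' z"] \<open>0 \<le> \<epsilon>\<close>
      by (simp add: dist inv power_mult_distrib)
  qed (use \<open>0 \<le> \<epsilon>\<close> in auto)
  then obtain z where "S (\<Phi> (S' z)) = z"
    using banach_fix_type[of "sqrt \<epsilon>" "\<lambda>z. S (\<Phi> (S' z))"] assms(3,4) by auto
  then have "\<Phi> (S' z) = S' z" by (metis inv(2))
  then show ?thesis by (rule that)
qed

text \<open>The linear terms of the lower bounds for \<open>f\<close> and \<open>g \<circ> A\<close> cancel, because
  \<open>\<langle>A\<^sup>T v, y - x\<rangle> = \<langle>v, A y - A x\<rangle>\<close>.\<close>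
lemma optimality_quadratic_growth:
  fixes A :: "'a::euclidean_space \<Rightarrow> 'b::euclidean_space"
  assumes A: "linear A" and sc: "strongly_convex f grad_f \<mu>"
    and sub: "subgradient g (A x) v" and grad: "grad_f x = - adjoint A v"
  shows "ereal (f x) + g (A x) + ereal (\<mu> / 2 * (norm (y - x))\<^sup>2) \<le> ereal (f y) + g (A y)"
proof -
  have "f y \<ge> f x + grad_f x \<bullet> (y - x) + \<mu> / 2 * (norm (y - x))\<^sup>2"
    using sc unfolding strongly_convex_def by blast
  moreover have "grad_f x \<bullet> (y - x) = - (v \<bullet> (A y - A x))"
    unfolding grad by (simp add: adjoint_clauses[OF A] linear_diff[OF A])
  moreover have "g (A x) + ereal (v \<bullet> (A y - A x)) \<le> g (A y)"
    using sub by (simp add: subgradient_def)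
  ultimately show ?thesis
    by (cases "g (A x)"; cases "g (A y)") auto
qed

lemma converges_linearlyI:
  assumes "a > 0" "0 \<le> \<epsilon>" "\<epsilon> < 1"
    and D: "\<And>n. a * (norm (x n - l))\<^sup>2 \<le> D n" "\<And>n. D (Suc n) \<le> \<epsilon> * D n"
  shows "converges_linearly x l"
proof -
  have Dn: "D n \<le> \<epsilon> ^ n * D 0" for n
  proof (induction n)
    case (Suc n)
    then show ?case using D(2)[of n] mult_left_mono[OF Suc \<open>0 \<le> \<epsilon>\<close>] by (simp add: mult.assoc)
  qed simp
  have bound: "norm (x n - l) \<le> sqrt (D 0 / a) * sqrt \<epsilon> ^ n" for n
  proof -
    have "(norm (x n - l))\<^sup>2 \<le> (D 0 / a) * \<epsilon> ^ n"
      using order_trans[OF D(1) Dn, of n] \<open>a > 0\<close> by (simp add: field_simps)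
    then have "sqrt ((norm (x n - l))\<^sup>2) \<le> sqrt ((D 0 / a) * \<epsilon> ^ n)"
      by (rule real_sqrt_le_mono)
    then show ?thesis
      unfolding real_sqrt_abs abs_norm_cancel real_sqrt_mult real_sqrt_power[of \<epsilon>] .
  qed
  have q: "0 \<le> sqrt \<epsilon>" "sqrt \<epsilon> < 1" using assms by auto
  then have "(\<lambda>n. sqrt (D 0 / a) * sqrt \<epsilon> ^ n) \<longlonglongrightarrow> 0"
    by (intro tendsto_mult_right_zero LIMSEQ_power_zero) simp
  with always_eventually[OF allI[OF bound]] have "(\<lambda>n. x n - l) \<longlonglongrightarrow> 0"
    by (rule Lim_null_comparison)
  then have "x \<longlonglongrightarrow> l" by (rule LIM_zero_cancel)
  then show ?thesis unfolding converges_linearly_def using bound q by blast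
qed

theorem theorem2:
  fixes f :: "'a::euclidean_space \<Rightarrow> real" and grad_f :: "'a \<Rightarrow> 'a"
    and g :: "'b::euclidean_space \<Rightarrow> ereal"
    and h :: "'a \<Rightarrow> real"
    and A :: "'a \<Rightarrow> 'b"
    and L \<alpha> \<beta> \<gamma> \<mu> \<sigma> :: real and kmax :: nat
    and u :: "nat \<Rightarrow> 'a" and U :: "nat \<Rightarrow> nat \<Rightarrow> 'a" and V :: "nat \<Rightarrow> nat \<Rightarrow> 'b"
  assumes "convex_on UNIV f"
    and "\<And>x. GDERIV f x :> grad_f x"
    and "L > 0" and "L-lipschitz_on UNIV grad_f"
    and "proper g" and "convex_ereal g" and "lower_semicontinuous g"
    and "h = (\<lambda>_. 0)"
    and "linear A"
    and "0 < \<alpha>" and "\<alpha> < 2 / L"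
    and "0 < \<beta>" and "\<beta> < 1 / (largest_singular_value A)\<^sup>2"
    and "kmax \<ge> 1"
    and "\<mu> > 0" and "strongly_convex f grad_f \<mu>"
    and "\<sigma> > 0" and "\<And>v. norm (adjoint A v) \<ge> \<sigma> * norm v"
    and "nested_primal_dual grad_f g (\<lambda>x. ereal (h x)) A \<alpha> \<beta> kmax u U V"
    and "\<gamma> = 1 / real kmax"
  shows "\<exists>u_hat.
     is_arg_min (\<lambda>x. ereal (f x) + g (A x) + ereal (h x)) (\<lambda>_. True) u_hat \<and>
     (\<forall>w. is_arg_min (\<lambda>x. ereal (f x) + g (A x) + ereal (h x)) (\<lambda>_. True) w \<longrightarrow> w = u_hat) \<and>
     (\<exists>v_hat \<epsilon>.
        u_hat = prox (\<lambda>x. ereal \<alpha> * ereal (h x))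
                  (u_hat - \<alpha> *\<^sub>R grad_f u_hat - \<alpha> *\<^sub>R adjoint A v_hat) \<and>
        v_hat = prox (\<lambda>w. ereal (\<beta> / \<alpha>) * fenchel_dual g w)
                  (v_hat + (\<beta> / \<alpha>) *\<^sub>R A u_hat) \<and>
        0 \<le> \<epsilon> \<and> \<epsilon> < 1 \<and>
        (\<forall>n. \<beta> * (norm (u (Suc n) - u_hat))\<^sup>2 + \<alpha>\<^sup>2 * \<gamma> * (norm (V (Suc n) 0 - v_hat))\<^sup>2
              \<le> \<epsilon> * (\<beta> * (norm (u n - u_hat))\<^sup>2 + \<alpha>\<^sup>2 * \<gamma> * (norm (V n 0 - v_hat))\<^sup>2))) \<and>
     converges_linearly u u_hat"
proof -
  note A = \<open>linear A\<close> and g = \<open>proper g\<close> \<open>convex_ereal g\<close> \<open>lower_semicontinuous g\<close>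
  note coer = assms(18)
  define \<tau> where "\<tau> = \<beta> / \<alpha>"
  define B where "B = adjoint A"
  define P where "P = prox (\<lambda>w. ereal \<tau> * fenchel_dual g w)"
  define T where "T x = x - \<alpha> *\<^sub>R grad_f x" for x
  have "\<tau> > 0" using assms(10,12) by (simp add: \<tau>_def)
  have B: "linear B" unfolding B_def by (rule adjoint_linear[OF A])

  have "\<sigma> \<le> onorm A" by (rule coercivity_le_onorm[OF A coer])
  then have "onorm A > 0" using \<open>\<sigma> > 0\<close> by simp
  then have \<beta>A: "\<beta> * (onorm A)\<^sup>2 < 1"
    using assms(13) by (simp add: largest_singular_value_eq_onorm[OF A] field_simps)
  have \<beta>\<sigma>: "0 \<le> 1 - \<beta> * \<sigma>\<^sup>2" "1 - \<beta> * \<sigma>\<^sup>2 < 1"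
  proof -
    have "\<beta> * \<sigma>\<^sup>2 \<le> \<beta> * (onorm A)\<^sup>2"
      using \<open>\<sigma> \<le> onorm A\<close> \<open>\<sigma> > 0\<close> \<open>0 < \<beta>\<close> by (intro mult_left_mono power_mono) auto
    with \<beta>A show "0 \<le> 1 - \<beta> * \<sigma>\<^sup>2" by simp
    show "1 - \<beta> * \<sigma>\<^sup>2 < 1" using \<open>\<sigma> > 0\<close> \<open>0 < \<beta>\<close> by simp
  qed

  define \<epsilon> where "\<epsilon> = max (1 - \<alpha> * (2 - \<alpha> * L) * \<mu>) (1 - \<beta> * \<sigma>\<^sup>2)"
  have "\<alpha> * (2 - \<alpha> * L) * \<mu> > 0"
    using \<open>\<alpha> < 2 / L\<close> \<open>L > 0\<close> \<open>0 < \<alpha>\<close> \<open>\<mu> > 0\<close> by (simp add: field_simps)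
  then have \<epsilon>: "0 \<le> \<epsilon>" "\<epsilon> < 1" using \<beta>\<sigma> by (auto simp: \<epsilon>_def)
  have T: "(norm (T x - T y))\<^sup>2 \<le> \<epsilon> * (norm (x - y))\<^sup>2" for x y
  proof -
    have "(norm (T x - T y))\<^sup>2 \<le> (1 - \<alpha> * (2 - \<alpha> * L) * \<mu>) * (norm (x - y))\<^sup>2"
      unfolding T_def by (rule gradient_step_contracts[OF assms(2-4) assms(15,16,10,11)])
    also have "\<dots> \<le> \<epsilon> * (norm (x - y))\<^sup>2" by (intro mult_right_mono) (auto simp: \<epsilon>_def)
    finally show ?thesis .
  qed
  have P: "(norm (P a - P b))\<^sup>2 \<le> (P a - P b) \<bullet> (a - b)" for a b
    unfolding P_def by (rule prox_dual_firmly_nonexpansive[OF g \<open>\<tau> > 0\<close>])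

  \<comment> \<open>one outer iteration, for the difference of two runs; it serves both for the fixed point
    (\<open>K = 1\<close>) and for the convergence of the iterates (\<open>K = kmax\<close>)\<close>
  have outer: "\<beta> * (norm ((1 / real K) *\<^sub>R (\<Sum>k=1..K. T x - T y - \<alpha> *\<^sub>R B (e k))))\<^sup>2
        + \<alpha>\<^sup>2 * (1 / real K) * (norm (e K))\<^sup>2
      \<le> \<epsilon> * (\<beta> * (norm (x - y))\<^sup>2 + \<alpha>\<^sup>2 * (1 / real K) * (norm (e 0))\<^sup>2)"
    if "K \<ge> 1" and firm: "\<And>k. k < K \<Longrightarrow> (norm (e (Suc k)))\<^sup>2
      \<le> e (Suc k) \<bullet> (e k + (\<beta> / \<alpha>) *\<^sub>R A (T x - T y - \<alpha> *\<^sub>R B (e k)))" for K x y and e :: "nat \<Rightarrow> 'b"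
  proof -
    have "\<beta> * (norm ((1 / real K) *\<^sub>R (\<Sum>k=1..K. T x - T y - \<alpha> *\<^sub>R B (e k))))\<^sup>2
        + \<alpha>\<^sup>2 * (1 / real K) * (norm (e K))\<^sup>2
      \<le> \<beta> * (norm (T x - T y))\<^sup>2 + (1 - \<beta> * \<sigma>\<^sup>2) * (\<alpha>\<^sup>2 * (1 / real K) * (norm (e 0))\<^sup>2)"
      unfolding B_def using \<beta>A firm[unfolded B_def]
      by (intro nested_loop_contracts A coer that(1) assms) auto
    also have "\<dots> \<le> \<beta> * (\<epsilon> * (norm (x - y))\<^sup>2) + \<epsilon> * (\<alpha>\<^sup>2 * (1 / real K) * (norm (e 0))\<^sup>2)"
      using T[of x y] \<open>0 < \<beta>\<close>
      by (intro add_mono mult_left_mono mult_right_mono) (auto simp: \<epsilon>_def)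
    finally show ?thesis by (simp add: algebra_simps)
  qed

  \<comment> \<open>the algorithm with a single inner step, as a map on pairs of a primal and a dual point\<close>
  define v1 where "v1 z = P (snd z + \<tau> *\<^sub>R A (T (fst z) - \<alpha> *\<^sub>R B (snd z)))" for z
  have contr: "\<beta> * (norm ((T (fst y) - \<alpha> *\<^sub>R B (v1 y)) - (T (fst z) - \<alpha> *\<^sub>R B (v1 z))))\<^sup>2
        + \<alpha>\<^sup>2 * (norm (v1 y - v1 z))\<^sup>2
      \<le> \<epsilon> * (\<beta> * (norm (fst y - fst z))\<^sup>2 + \<alpha>\<^sup>2 * (norm (snd y - snd z))\<^sup>2)" for y z
  proof -
    define e where "e k = (if k = 0 then snd y - snd z else v1 y - v1 z)" for k :: nat
    define x where "x z = T (fst z) - \<alpha> *\<^sub>R B (snd z)" for z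
    have diff: "T (fst y) - T (fst z) - \<alpha> *\<^sub>R B (e 0) = x y - x z"
      by (simp add: e_def x_def linear_diff[OF B] algebra_simps)
    have arg: "e 0 + (\<beta> / \<alpha>) *\<^sub>R A (T (fst y) - T (fst z) - \<alpha> *\<^sub>R B (e 0))
        = (snd y + \<tau> *\<^sub>R A (x y)) - (snd z + \<tau> *\<^sub>R A (x z))"
      unfolding diff
      by (simp add: e_def \<tau>_def linear_diff[OF A] algebra_simps)
    have "(norm (e 1))\<^sup>2 \<le> e 1 \<bullet> (e 0 + (\<beta> / \<alpha>) *\<^sub>R A (T (fst y) - T (fst z) - \<alpha> *\<^sub>R B (e 0)))"
      using P[of "snd y + \<tau> *\<^sub>R A (x y)" "snd z + \<tau> *\<^sub>R A (x z)"] unfolding arg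
      by (simp add: e_def v1_def x_def)
    then show ?thesis
      using outer[of 1 e "fst y" "fst z"] by (simp add: e_def linear_diff[OF B] algebra_simps)
  qed
  obtain z where "(T (fst z) - \<alpha> *\<^sub>R B (v1 z), v1 z) = z"
    using weighted_contraction_fixed_point[of \<beta> "\<alpha>\<^sup>2" \<epsilon> "\<lambda>z. (T (fst z) - \<alpha> *\<^sub>R B (v1 z), v1 z)"]
      contr \<epsilon> \<open>0 < \<alpha>\<close> \<open>0 < \<beta>\<close> by auto
  then obtain u_hat v_hat where
    u_hat: "T u_hat - \<alpha> *\<^sub>R B v_hat = u_hat" and "P (v_hat + \<tau> *\<^sub>R A (T u_hat - \<alpha> *\<^sub>R B v_hat)) = v_hat"
    unfolding v1_def by (metis fst_conv snd_conv)
  then have v_hat: "P (v_hat + \<tau> *\<^sub>R A u_hat) = v_hat" by simp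

  have sub: "subgradient g (A u_hat) v_hat"
    using prox_dual_subgradient[OF g \<open>\<tau> > 0\<close>, of "v_hat + \<tau> *\<^sub>R A u_hat"] \<open>\<tau> > 0\<close>
    by (simp add: v_hat flip: P_def)
  have "\<alpha> *\<^sub>R (grad_f u_hat + B v_hat) = 0" using u_hat by (simp add: T_def algebra_simps)
  then have grad: "grad_f u_hat = - adjoint A v_hat"
    using \<open>0 < \<alpha>\<close> by (simp add: B_def eq_neg_iff_add_eq_0)
  \<comment> \<open>the fixed point satisfies the optimality conditions of the minimization problem\<close>
  have growth: "ereal (f u_hat) + g (A u_hat) + ereal (\<mu> / 2 * (norm (y - u_hat))\<^sup>2) \<le> ereal (f y) + g (A y)" for y
    by (rule optimality_quadratic_growth[OF A \<open>strongly_convex f grad_f \<mu>\<close> sub grad])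
  obtain r where r: "g (A u_hat) = ereal r" using subgradient_finite[OF g(1) sub] .
  have less: "ereal (f u_hat) + g (A u_hat) < ereal (f y) + g (A y)" if "y \<noteq> u_hat" for y
  proof -
    have "ereal (f u_hat) + g (A u_hat) < ereal (f u_hat) + g (A u_hat) + ereal (\<mu> / 2 * (norm (y - u_hat))\<^sup>2)"
      using that \<open>\<mu> > 0\<close> by (simp add: r)
    then show ?thesis using growth[of y] by (rule less_le_trans)
  qed

  define D where "D n = \<beta> * (norm (u n - u_hat))\<^sup>2 + \<alpha>\<^sup>2 * \<gamma> * (norm (V n 0 - v_hat))\<^sup>2" for n
  have D: "D (Suc n) \<le> \<epsilon> * D n" for n
  proof -
    have npd: "(m > 0 \<longrightarrow> V m 0 = V (m - 1) kmax)
        \<and> (\<forall>k<kmax. U m k = T (u m) - \<alpha> *\<^sub>R B (V m k) \<and> V m (Suc k) = P (V m k + \<tau> *\<^sub>R A (U m k)))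
        \<and> U m kmax = T (u m) - \<alpha> *\<^sub>R B (V m kmax)
        \<and> u (Suc m) = (1 / real kmax) *\<^sub>R (\<Sum>k=1..kmax. U m k)" for m
      using assms(19) unfolding nested_primal_dual_def P_def \<tau>_def T_def B_def \<open>h = (\<lambda>_. 0)\<close> prox_zero
      by blast
    have alg: "V (Suc n) 0 = V n kmax"
      "\<And>k. k \<le> kmax \<Longrightarrow> U n k = T (u n) - \<alpha> *\<^sub>R B (V n k)"
      "\<And>k. k < kmax \<Longrightarrow> V n (Suc k) = P (V n k + \<tau> *\<^sub>R A (U n k))"
      "u (Suc n) = (1 / real kmax) *\<^sub>R (\<Sum>k=1..kmax. U n k)"
      using npd[of "Suc n"] npd[of n] le_neq_implies_less by (simp, metis, metis, metis)
    define e where "e k = V n k - v_hat" for k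
    have U: "T (u n) - T u_hat - \<alpha> *\<^sub>R B (e k) = U n k - u_hat" if "k \<le> kmax" for k
      using alg(2)[OF that] u_hat by (simp add: e_def linear_diff[OF B] algebra_simps)
    have firm: "(norm (e (Suc k)))\<^sup>2
      \<le> e (Suc k) \<bullet> (e k + (\<beta> / \<alpha>) *\<^sub>R A (T (u n) - T u_hat - \<alpha> *\<^sub>R B (e k)))" if "k < kmax" for k
    proof -
      have "e k + (\<beta> / \<alpha>) *\<^sub>R A (T (u n) - T u_hat - \<alpha> *\<^sub>R B (e k))
          = (V n k + \<tau> *\<^sub>R A (U n k)) - (v_hat + \<tau> *\<^sub>R A u_hat)"
        using that by (simp add: U) (simp add: e_def \<tau>_def linear_diff[OF A] algebra_simps)
      moreover have "e (Suc k) = P (V n k + \<tau> *\<^sub>R A (U n k)) - P (v_hat + \<tau> *\<^sub>R A u_hat)"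
        using that by (simp only: e_def alg(3) v_hat)
      ultimately show ?thesis using P by simp
    qed
    have "(\<Sum>k=1..kmax. T (u n) - T u_hat - \<alpha> *\<^sub>R B (e k)) = (\<Sum>k=1..kmax. U n k - u_hat)"
      by (intro sum.cong) (auto simp: U)
    then have "\<beta> * (norm ((1 / real kmax) *\<^sub>R (\<Sum>k=1..kmax. U n k - u_hat)))\<^sup>2
        + \<alpha>\<^sup>2 * \<gamma> * (norm (V (Suc n) 0 - v_hat))\<^sup>2 \<le> \<epsilon> * D n"
      using outer[of kmax e "u n" u_hat, OF \<open>kmax \<ge> 1\<close> firm]
      by (simp only: D_def e_def alg(1) \<open>\<gamma> = 1 / real kmax\<close>)
    moreover have "(1 / real kmax) *\<^sub>R (\<Sum>k=1..kmax. U n k - u_hat) = u (Suc n) - u_hat"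
      using \<open>kmax \<ge> 1\<close> by (simp add: alg(4) sum_subtractf scaleR_diff_right sum_constant_scaleR)
    ultimately show ?thesis by (simp only: D_def)
  qed

  have "converges_linearly u u_hat"
    by (rule converges_linearlyI[where D = D, OF \<open>0 < \<beta>\<close> \<epsilon> _ D]) (simp add: D_def \<open>\<gamma> = 1 / real kmax\<close>)
  moreover have "is_arg_min (\<lambda>x. ereal (f x) + g (A x) + ereal (h x)) (\<lambda>_. True) u_hat"
    unfolding is_arg_min_def \<open>h = (\<lambda>_. 0)\<close> using less by (auto dest: less_asym)
  moreover have "w = u_hat" if "is_arg_min (\<lambda>x. ereal (f x) + g (A x) + ereal (h x)) (\<lambda>_. True) w" for w
    using that less unfolding is_arg_min_def \<open>h = (\<lambda>_. 0)\<close> by auto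
  moreover have "u_hat = prox (\<lambda>x. ereal \<alpha> * ereal (h x))
      (u_hat - \<alpha> *\<^sub>R grad_f u_hat - \<alpha> *\<^sub>R adjoint A v_hat)"
    unfolding \<open>h = (\<lambda>_. 0)\<close> prox_zero using u_hat by (simp add: T_def B_def)
  moreover have "v_hat = prox (\<lambda>w. ereal (\<beta> / \<alpha>) * fenchel_dual g w) (v_hat + (\<beta> / \<alpha>) *\<^sub>R A u_hat)"
    using v_hat by (simp add: P_def \<tau>_def)
  ultimately show ?thesis using \<epsilon> D unfolding D_def by blast
qed

end
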